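(* Let $d$ be a fixed positive integer. Then: (1) $(\beta_n^d/n^d)_n$ is a sequence in $[0,1]$ with $\limsup_{n\to\infty}\frac{\beta_n^d}{n^d}=1$; (2) $\beta_n^d=\mathcal{O}(n^d)$, but $\beta_n^d$ is not $\mathcal{O}(n^{d-\epsilon})$ for any $\epsilon>0$.
   Context: $\mathbb{Z}_n$ is the ring of integers modulo $n$, identified with $\{0,\dots,n-1\}$; a vector $(v_1,\dots,v_d)\in\mathbb{Z}_n^d$ is zero-sum-free if no non-empty subset of its components sums to $0$ in $\mathbb{Z}_n$; $\beta_n^d$ is the number of zero-sum-free $(x_1,\dots,x_d)\in\mathbb{Z}_n^d$ with $\gcd(x_1,\dots,x_d,n)=1$. $a_n=\mathcal{O}(b_n)$ means there are a constant $K>0$ and an integer $N$ with $|a_n|\leq K b_n$ for all $n\geq N$. *)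

theory Defs
  imports
    "HOL-Analysis.Analysis"
    "HOL-Library.Landau_Symbols"
    "HOL-Number_Theory.Cong"
begin

text \<open>
  A vector of \<open>\<int>\<^sub>n\<^sup>d\<close> is an extensional function from \<open>{1..d}\<close> to the representatives \<open>{0..<n}\<close>.
  Subsets of the components are subsets of the index set, so that equal entries at different
  positions count separately.
\<close>

definition zn_vectors :: "nat \<Rightarrow> nat \<Rightarrow> (nat \<Rightarrow> nat) set" where
  "zn_vectors n d = {1..d} \<rightarrow>\<^sub>E {0..<n}"

definition zero_sum_free :: "nat \<Rightarrow> nat \<Rightarrow> (nat \<Rightarrow> nat) \<Rightarrow> bool" where
  "zero_sum_free n d v \<longleftrightarrow> (\<forall>I. I \<subseteq> {1..d} \<and> I \<noteq> {} \<longrightarrow> \<not> [(\<Sum>i\<in>I. v i) = 0] (mod n))"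

definition zsf_count :: "nat \<Rightarrow> nat \<Rightarrow> nat" where
  "zsf_count n d =
     card {x \<in> zn_vectors n d. zero_sum_free n d x \<and> Gcd (insert n (x ` {1..d})) = 1}"

end

theory Submission
  imports Defs "HOL-Computational_Algebra.Primes"
begin

text \<open>
  For each non-empty index set \<open>I\<close> at most \<open>n ^ (d - 1)\<close> vectors satisfy \<open>(\<Sum>i\<in>I. v i) = 0\<close> in
  \<open>\<int>\<^sub>n\<close>, because one component of \<open>I\<close> is determined by all the other components. Hence all but
  \<open>2 ^ d * n ^ (d - 1)\<close> vectors are zero-sum-free. If \<open>n\<close> is prime, then the gcd condition follows
  from zero-sum-freeness, so along the primes the ratio is at least \<open>1 - 2 ^ d / n\<close>.
\<close>

lemma finite_zn_vectors [simp]: "finite (zn_vectors n d)"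
  by (simp add: zn_vectors_def finite_PiE)

lemma card_zn_vectors [simp]: "card (zn_vectors n d) = n ^ d"
  by (simp add: zn_vectors_def card_PiE)

lemma zsf_count_le: "zsf_count n d \<le> n ^ d"
  unfolding zsf_count_def card_zn_vectors[symmetric] by (intro card_mono) auto

lemma card_zero_sum_le:
  assumes "I \<subseteq> {1..d}" "I \<noteq> {}"
  shows "card {v \<in> zn_vectors n d. [(\<Sum>i\<in>I. v i) = 0] (mod n)} \<le> n ^ (d - 1)"
proof -
  obtain k where k: "k \<in> I"
    using assms by blast
  define J where "J = {1..d} - {k}"
  have "finite I"
    using assms finite_subset by blast
  have "card J = d - 1"
    using k assms by (auto simp: J_def)
  \<comment> \<open>Count through the map that forgets coordinate \<open>k\<close>: its target, the
    vectors indexed by \<open>J\<close>, has \<open>n ^ (d - 1)\<close> elements.\<close>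
  have "inj_on (\<lambda>v. restrict v J) {v \<in> zn_vectors n d. [(\<Sum>i\<in>I. v i) = 0] (mod n)}"
  proof (rule inj_onI)
    fix v w
    assume "v \<in> {v \<in> zn_vectors n d. [(\<Sum>i\<in>I. v i) = 0] (mod n)}"
      and "w \<in> {v \<in> zn_vectors n d. [(\<Sum>i\<in>I. v i) = 0] (mod n)}"
      and eq: "restrict v J = restrict w J"
    then have v: "v \<in> {1..d} \<rightarrow>\<^sub>E {0..<n}" "[(\<Sum>i\<in>I. v i) = 0] (mod n)"
      and w: "w \<in> {1..d} \<rightarrow>\<^sub>E {0..<n}" "[(\<Sum>i\<in>I. w i) = 0] (mod n)"
      by (auto simp: zn_vectors_def)
    have agree: "v i = w i" if "i \<in> J" for i
      using fun_cong[OF eq, of i] that by simp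
    have "(\<Sum>i\<in>I - {k}. v i) = (\<Sum>i\<in>I - {k}. w i)"
      using assms by (intro sum.cong agree) (auto simp: J_def)
    \<comment> \<open>Each side is the full sum over \<open>I\<close> with the term at
      \<open>k\<close> split off, so both are congruent to 0. Cancelling the equal remainders
      isolates coordinate \<open>k\<close>, and for representatives below \<open>n\<close>
      congruence is equality.\<close>
    moreover have "[v k + (\<Sum>i\<in>I - {k}. v i) = w k + (\<Sum>i\<in>I - {k}. w i)] (mod n)"
      using v(2) w(2) by (simp add: sum.remove[OF \<open>finite I\<close> k] cong_def)
    ultimately have "[v k = w k] (mod n)"
      by (simp add: cong_add_rcancel_nat)
    moreover have "v k < n" "w k < n"
      using v(1) w(1) k assms(1) by (auto simp: PiE_iff)
    ultimately have "v k = w k"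
      by (simp add: cong_def)
    then show "v = w"
      using agree by (intro PiE_ext[OF v(1) w(1)]) (auto simp: J_def)
  qed
  moreover have "(\<lambda>v. restrict v J) ` {v \<in> zn_vectors n d. [(\<Sum>i\<in>I. v i) = 0] (mod n)}
      \<subseteq> J \<rightarrow>\<^sub>E {0..<n}"
    by (auto simp: zn_vectors_def J_def PiE_iff split: if_splits)
  moreover have "finite (J \<rightarrow>\<^sub>E {0..<n})"
    by (intro finite_PiE) (auto simp: J_def)
  ultimately have "card {v \<in> zn_vectors n d. [(\<Sum>i\<in>I. v i) = 0] (mod n)} \<le> card (J \<rightarrow>\<^sub>E {0..<n})"
    by (rule card_inj_on_le)
  also have "\<dots> = n ^ (d - 1)"
    using \<open>card J = d - 1\<close> by (subst card_PiE) (auto simp: J_def)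
  finally show ?thesis .
qed

text \<open>Union bound: a vector that is not zero-sum-free lies in the zero-sum set of some
  non-empty \<open>I\<close>, and there are at most \<open>2 ^ d\<close> such \<open>I\<close>. The
  additive form avoids truncated subtraction on naturals.\<close>

lemma card_zero_sum_free_ge:
  "n ^ d \<le> card {v \<in> zn_vectors n d. zero_sum_free n d v} + 2 ^ d * n ^ (d - 1)"
proof -
  define Idx where "Idx = Pow {1..d} - {{}}"
  define Z where "Z I = {v \<in> zn_vectors n d. [(\<Sum>i\<in>I. v i) = 0] (mod n)}" for I
  have "finite Idx"
    by (simp add: Idx_def)
  have "card Idx \<le> card (Pow {1..d})"
    unfolding Idx_def by (intro card_mono) auto
  then have cI: "card Idx \<le> 2 ^ d"
    by (simp add: card_Pow)
  have "card (\<Union>I\<in>Idx. Z I) \<le> (\<Sum>I\<in>Idx. card (Z I))"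
    by (rule card_UN_le[OF \<open>finite Idx\<close>])
  also have "\<dots> \<le> card Idx * n ^ (d - 1)"
    using sum_bounded_above[of Idx "\<lambda>I. card (Z I)" "n ^ (d - 1)"] card_zero_sum_le
    by (auto simp: Idx_def Z_def)
  also have "\<dots> \<le> 2 ^ d * n ^ (d - 1)"
    using cI by simp
  finally have Z: "card (\<Union>I\<in>Idx. Z I) \<le> 2 ^ d * n ^ (d - 1)" .
  have "zn_vectors n d = {v \<in> zn_vectors n d. zero_sum_free n d v} \<union> (\<Union>I\<in>Idx. Z I)"
    by (auto simp: zero_sum_free_def Idx_def Z_def)
  then have "n ^ d \<le> card {v \<in> zn_vectors n d. zero_sum_free n d v} + card (\<Union>I\<in>Idx. Z I)"
    by (metis card_Un_le card_zn_vectors)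
  with Z show ?thesis
    by linarith
qed

text \<open>The singleton index set \<open>{1}\<close>, available because \<open>d \<ge> 1\<close>,
  shows that \<open>p\<close> does not divide \<open>v 1\<close>. The gcd divides both
  \<open>p\<close> and \<open>v 1\<close>, which are therefore coprime.\<close>

lemma Gcd_eq_1_if_zero_sum_free_prime:
  assumes "prime p" "d \<ge> 1" "zero_sum_free p d v"
  shows "Gcd (insert p (v ` {1..d})) = 1"
proof -
  have "\<not> p dvd v 1"
    using assms(3)[unfolded zero_sum_free_def, rule_format, of "{1}"] assms(2)
    by (simp add: cong_0_iff)
  then have "coprime p (v 1)"
    using assms(1) prime_imp_coprime by blast
  moreover have "Gcd (insert p (v ` {1..d})) dvd p" "Gcd (insert p (v ` {1..d})) dvd v 1"
    using assms(2) by (intro Gcd_dvd; simp)+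
  ultimately show ?thesis
    by (meson coprime_common_divisor nat_dvd_1_iff_1)
qed

lemma zsf_count_prime_ratio_ge:
  assumes "prime p" "d \<ge> 1"
  shows "1 - 2 ^ d / real p \<le> real (zsf_count p d) / real p ^ d"
proof -
  have p: "real p > 0"
    using assms(1) prime_gt_0_nat by simp
  have "zsf_count p d = card {v \<in> zn_vectors p d. zero_sum_free p d v}"
    unfolding zsf_count_def using Gcd_eq_1_if_zero_sum_free_prime[OF assms]
    by (intro arg_cong[where f = card]) auto
  then have "p ^ d \<le> zsf_count p d + 2 ^ d * p ^ (d - 1)"
    using card_zero_sum_free_ge[of p d] by simp
  then have "real (p ^ d) \<le> real (zsf_count p d + 2 ^ d * p ^ (d - 1))"
    by (simp only: of_nat_le_iff)
  then have "real p ^ d - 2 ^ d * real p ^ (d - 1) \<le> real (zsf_count p d)"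
    by simp
  then have "(real p ^ d - 2 ^ d * real p ^ (d - 1)) / real p ^ d \<le> real (zsf_count p d) / real p ^ d"
    using p by (intro divide_right_mono) auto
  \<comment> \<open>Here \<open>d \<ge> 1\<close> keeps \<open>d - 1\<close> from truncating, so the
    error term \<open>2 ^ d * p ^ (d - 1)\<close> divided by \<open>p ^ d\<close> is exactly
    \<open>2 ^ d / p\<close>.\<close>
  moreover have "real p ^ d = real p * real p ^ (d - 1)"
    using assms(2) by (cases d) auto
  ultimately show ?thesis
    using p by (simp add: diff_divide_distrib)
qed

text \<open>If the denominator vanishes, the quotient has the default value 0, so the bounds hold at
  every index and can be fed to the limsup directly.\<close>

lemma zsf_count_ratio_bounds: "real (zsf_count n d) / real n ^ d \<in> {0..1}"
proof -
  have "real (zsf_count n d) \<le> real n ^ d"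
    using zsf_count_le[of n d] by (metis of_nat_le_iff of_nat_power)
  then show ?thesis
    by (auto simp: divide_le_eq_1)
qed

text \<open>The ratio is squeezed between \<open>1 - 2 ^ d / p\<close> and 1 along the increasing
  enumeration of the primes. This one subsequence serves both the lower bound on the limsup and the
  refutation of the smaller growth order.\<close>

lemma zsf_count_ratio_tendsto_along_primes:
  assumes "d \<ge> 1"
  obtains r :: "nat \<Rightarrow> nat" where "strict_mono r"
    "(\<lambda>k. real (zsf_count (r k) d) / real (r k) ^ d) \<longlonglongrightarrow> 1"
proof
  define r :: "nat \<Rightarrow> nat" where "r = enumerate {p. prime p}"
  show r: "strict_mono r"
    unfolding r_def by (rule strict_mono_enumerate[OF primes_infinite])
  have prime: "prime (r k)" for k
    using enumerate_in_set[OF primes_infinite, of k] by (simp add: r_def)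
  have "filterlim (\<lambda>k. real (r k)) at_top sequentially"
    by (intro filterlim_compose[OF filterlim_real_sequentially] filterlim_subseq r)
  then have "(\<lambda>k. 1 - 2 ^ d / real (r k)) \<longlonglongrightarrow> 1 - 0"
    by (intro tendsto_diff tendsto_const tendsto_divide_0[OF tendsto_const])
       (rule filterlim_at_top_imp_at_infinity)
  then have lower: "(\<lambda>k. 1 - 2 ^ d / real (r k)) \<longlonglongrightarrow> 1"
    by simp
  show "(\<lambda>k. real (zsf_count (r k) d) / real (r k) ^ d) \<longlonglongrightarrow> 1"
  proof (rule tendsto_sandwich[OF _ _ lower tendsto_const])
    show "\<forall>\<^sub>F k in sequentially. 1 - 2 ^ d / real (r k) \<le> real (zsf_count (r k) d) / real (r k) ^ d"
      by (intro always_eventually allI zsf_count_prime_ratio_ge prime assms)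
    show "\<forall>\<^sub>F k in sequentially. real (zsf_count (r k) d) / real (r k) ^ d \<le> 1"
      using zsf_count_ratio_bounds by (intro always_eventually allI) (meson atLeastAtMost_iff)
  qed
qed

theorem theorem6p3:
  fixes d :: nat
  assumes "d \<ge> 1"
  shows "((\<forall>n\<ge>1. real (zsf_count n d) / real n ^ d \<in> {0..1}) \<and>
          limsup (\<lambda>n. ereal (real (zsf_count n d) / real n ^ d)) = 1) \<and>
         ((\<lambda>n. real (zsf_count n d)) \<in> O(\<lambda>n. real n ^ d) \<and>
          (\<forall>\<epsilon>::real. \<epsilon> > 0 \<longrightarrow>
             (\<lambda>n. real (zsf_count n d)) \<notin> O(\<lambda>n. real n powr (real d - \<epsilon>))))"
proof -
  define f where "f n = real (zsf_count n d) / real n ^ d" for n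
  obtain r where r: "strict_mono r" and lim: "(\<lambda>k. f (r k)) \<longlonglongrightarrow> 1"
    using zsf_count_ratio_tendsto_along_primes[OF assms] unfolding f_def by blast
  have bounds: "f n \<in> {0..1}" for n
    unfolding f_def by (rule zsf_count_ratio_bounds)
  have "limsup (\<lambda>n. ereal (f n)) = 1"
  proof (rule antisym)
    show "limsup (\<lambda>n. ereal (f n)) \<le> 1"
      using bounds by (intro Limsup_bounded) auto
    \<comment> \<open>The limsup of a subsequence never exceeds that of the whole sequence, so the
      limit 1 along the primes bounds the limsup from below.\<close>
    have "(\<lambda>k. ereal (f (r k))) \<longlonglongrightarrow> ereal 1"
      using lim by simp
    then have "limsup ((\<lambda>n. ereal (f n)) \<circ> r) = 1"
      by (auto simp: o_def one_ereal_def intro: lim_imp_Limsup)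
    then show "1 \<le> limsup (\<lambda>n. ereal (f n))"
      using limsup_subseq_mono[OF r, of "\<lambda>n. ereal (f n)"] by simp
  qed
  moreover have "(\<lambda>n. real (zsf_count n d)) \<in> O(\<lambda>n. real n ^ d)"
  proof (rule bigoI[where c = 1], intro always_eventually allI)
    fix n
    show "norm (real (zsf_count n d)) \<le> 1 * norm (real n ^ d)"
      using zsf_count_le[of n d] by (simp flip: of_nat_power)
  qed
  moreover have "(\<lambda>n. real (zsf_count n d)) \<notin> O(\<lambda>n. real n powr (real d - \<epsilon>))"
    if "\<epsilon> > 0" for \<epsilon> :: real
  proof
    assume "(\<lambda>n. real (zsf_count n d)) \<in> O(\<lambda>n. real n powr (real d - \<epsilon>))"
    then obtain c where
      "\<forall>\<^sub>F n in sequentially. norm (real (zsf_count n d)) \<le> c * norm (real n powr (real d - \<epsilon>))"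
      by (rule landau_o.bigE)
    \<comment> \<open>Divide the assumed bound by \<open>n ^ d\<close>. Positivity of
      \<open>n\<close> identifies \<open>real n powr real d\<close> with \<open>real n ^ d\<close>,
      leaving the exponent \<open>- \<epsilon>\<close>.\<close>
    then have "\<forall>\<^sub>F n in sequentially. f n \<le> c * real n powr - \<epsilon>"
      using eventually_gt_at_top[of 0]
    proof eventually_elim
      case (elim n)
      then have "f n \<le> c * real n powr (real d - \<epsilon>) / real n ^ d"
        unfolding f_def by (intro divide_right_mono) auto
      also have "\<dots> = c * real n powr - \<epsilon>"
        using elim(2) by (simp add: powr_diff powr_minus powr_realpow field_simps)
      finally show ?case .
    qed
    then have "\<forall>\<^sub>F k in sequentially. f (r k) \<le> c * real (r k) powr - \<epsilon>"
      by (rule eventually_subseq[OF r])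
    \<comment> \<open>Along the primes the left side tends to 1, while the right side tends to 0
      since \<open>\<epsilon> > 0\<close>, whatever the constant \<open>c\<close>; passing to the
      limit gives the contradiction.\<close>
    moreover have "(\<lambda>k. c * real (r k) powr - \<epsilon>) \<longlonglongrightarrow> c * 0"
      using that
      by (intro tendsto_mult tendsto_const tendsto_neg_powr
          filterlim_compose[OF filterlim_real_sequentially] filterlim_subseq r) auto
    ultimately have "1 \<le> c * 0"
      using lim by (intro tendsto_le[OF _ _ lim]) auto
    then show False
      by simp
  qed
  ultimately show ?thesis
    using bounds unfolding f_def by blast
qed

end
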